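(* Let $a>b>0$, $c>0$, $H>0$, and put $\lambda=\sqrt{1+H^2/c^2}>1$. Assume $\left|\frac{a^2(1-\lambda^2)}{c^2\lambda^2}\right|<1$. Let $\Sigma$ be the surface $z=c\left(\frac{x^2}{a^2}+\frac{y^2}{b^2}-1\right)^{1/2}$ lying between the planes $z=0$ and $z=H$, i.e. the graph of this function over the region $\{(x,y):1\le \frac{x^2}{a^2}+\frac{y^2}{b^2}\le\lambda^2\}$ (the upper part of the hyperboloid of one sheet $\frac{x^2}{a^2}+\frac{y^2}{b^2}-\frac{z^2}{c^2}=1$), so that its area is $$\hat S=\iint_{1\le x^2/a^2+y^2/b^2\le\lambda^2}\sqrt{1+\Big(\tfrac{\partial z}{\partial x}\Big)^2+\Big(\tfrac{\partial z}{\partial y}\Big)^2}\,dx\,dy .$$ Then $$\hat S=\frac{2\pi b^2c\sqrt{\lambda^2-1}}{\lambda a}\sum_{m,n,p=0}^{\infty}\frac{(\tfrac12)_{n+p}\,(\tfrac12)_m\,(2)_n\,(-\tfrac12)_p\,(-\tfrac12)_p}{(-\tfrac12)_{p-m}\,(\tfrac32)_{n+p}\,(1)_m\;m!\,n!\,p!}\left(\frac{b^2}{a^2}-1\right)^{m}\left(1-\frac{1}{\lambda^2}\right)^{n}\left(\frac{a^2(1-\lambda^2)}{c^2\lambda^2}\right)^{p}.$$ In the notation of Srivastava–Daoust functions this triple series times the prefactor is written $\frac{2\pi b^2c\sqrt{\lambda^2-1}}{\lambda a}F^{1:1;1;2}_{2:1;0;0}\big([\tfrac12:0,1,1]:[\tfrac12:1];[2:1];[-\tfrac12:1],[-\tfrac12:1];\,[-\tfrac12:-1,0,1],[\tfrac32:0,1,1]:[1:1];-;-;\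 \tfrac{b^2}{a^2}-1,\,1-\tfrac1{\lambda^2},\,\tfrac{a^2(1-\lambda^2)}{c^2\lambda^2}\big)$.
   Context: $(\alpha)_k=\Gamma(\alpha+k)/\Gamma(\alpha)$ is the Pochhammer symbol, defined for all integers $k$ (possibly negative) whenever the Gamma quotient is defined; in particular $(-\tfrac12)_{p-m}=\Gamma(-\tfrac12+p-m)/\Gamma(-\tfrac12)$. Note $|b^2/a^2-1|<1$ and $|1-1/\lambda^2|<1$ hold automatically under the hypotheses. *)

theory Defs
  imports "HOL-Analysis.Analysis"
begin

definition poch_int :: "real \<Rightarrow> int \<Rightarrow> real" where
  "poch_int \<alpha> k = Gamma (\<alpha> + of_int k) / Gamma \<alpha>"

definition sd_term :: "real \<Rightarrow> real \<Rightarrow> real \<Rightarrow> nat \<Rightarrow> nat \<Rightarrow> nat \<Rightarrow> real" where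
  "sd_term x y w m n p =
     (pochhammer (1/2) (n + p) * pochhammer (1/2) m * pochhammer 2 n
        * pochhammer (-1/2) p * pochhammer (-1/2) p)
     / (poch_int (-1/2) (int p - int m) * pochhammer (3/2) (n + p) * pochhammer 1 m
        * fact m * fact n * fact p)
     * x ^ m * y ^ n * w ^ p"

end

theory Submission
  imports Defs
begin

text \<open>The area is brought to a double integral that separates the three summation indices. In slope
  coordinates $(x, y) = (x, x t)$ the even integrand is supported, for $x > 0$, on
  $1 \le q x^2 \le \lambda^2$ with $q = 1/a^2 + t^2/b^2$. The substitution $q x^2 = 1/(1 - Y s^2)$,
  $Y = 1 - 1/\lambda^2$, removes the singularity on the inner ellipse, and $t = (b^2/a^2) \tan \varphi$,
  rather than the polar angle, where $t = (b/a) \tan \theta$, leaves a constant multiple of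
  $\int\int D^{-3/2} \sqrt{1 - w D s^2} (1 - Y s^2)^{-2} ds\, d\varphi$ with
  $D = 1 + (b^2/a^2 - 1) \sin^2 \varphi \in (0, 1]$. This choice of angle replaces an Euler transformation
  of the ${}_2F_1$ in the index $m$. Expanding the root in powers of $w$, the factor
  $(1 - Y s^2)^{-2}$ in powers of $Y$ and $D^{p - 3/2}$ in powers of $b^2/a^2 - 1$ gives the series, whose
  terms are products of one factor in $p$, one in $(n, p)$ and one in $(m, p)$, so that the sums over
  $n$ and $m$ decouple for each fixed $p$.\<close>

section \<open>Binomial series, termwise integration and Wallis integrals\<close>

text \<open>This is Newton's series at exponent \<open>-\<alpha>\<close> and argument
  \<open>-z\<close>: the sign in (-alpha choose n) = (-1)^n (alpha)_n / n! cancels the sign of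
  \<open>(-z)^n\<close>.\<close>

lemma pochhammer_series_sums:
  fixes \<alpha> z :: real
  assumes "\<bar>z\<bar> < 1"
  shows "(\<lambda>n. pochhammer \<alpha> n / fact n * z ^ n) sums (1 - z) powr (-\<alpha>)"
proof -
  have "(\<lambda>n. ((-\<alpha>) gchoose n) * (-z)^n) sums (1 + (-z)) powr (-\<alpha>)"
    using assms by (intro gen_binomial_real) simp
  moreover have "((-\<alpha>) gchoose n) * (-z)^n = pochhammer \<alpha> n / fact n * z ^ n" for n
    by (simp add: gbinomial_pochhammer power_minus[of z])
  ultimately show ?thesis by simp
qed

text \<open>Convergence at a point s strictly between |r| and 1 forces absolute convergence at r.
  Every majorant below is such a series, possibly times a constant.\<close>

lemma pochhammer_series_abs_summable:
  fixes \<alpha> r :: real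
  assumes "\<bar>r\<bar> < 1"
  shows "summable (\<lambda>n. \<bar>pochhammer \<alpha> n / fact n\<bar> * \<bar>r\<bar> ^ n)"
proof -
  obtain s where s: "\<bar>r\<bar> < s" "s < 1" using dense assms by blast
  then have "summable (\<lambda>n. pochhammer \<alpha> n / fact n * s ^ n)"
    using pochhammer_series_sums[of s \<alpha>] by (auto simp: sums_iff)
  then have "summable (\<lambda>n. norm (pochhammer \<alpha> n / fact n * r ^ n))"
    by (rule powser_insidea) (use s in auto)
  then show ?thesis by (simp add: abs_mult power_abs)
qed

text \<open>The Weierstrass test makes the partial sums converge uniformly, so their integrals
  converge to the integral of the limit. Each of the expansions, in m, in n and twice in p, is
  integrated by this lemma.\<close>

lemma has_integral_sums_M_test:
  fixes f :: "nat \<Rightarrow> real \<Rightarrow> real"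
  assumes cont: "\<And>k. continuous_on {l..u} (f k)"
    and bound: "\<And>k x. x \<in> {l..u} \<Longrightarrow> \<bar>f k x\<bar> \<le> M k" and M: "summable M"
    and f_int: "\<And>k. (f k has_integral I k) {l..u}"
    and g: "\<And>x. x \<in> {l..u} \<Longrightarrow> (\<lambda>k. f k x) sums g x"
  shows "summable I" and "(g has_integral (\<Sum>k. I k)) {l..u}"
proof -
  have "uniform_limit {l..u} (\<lambda>n x. \<Sum>i<n. f i x) (\<lambda>x. suminf (\<lambda>i. f i x)) sequentially"
    by (rule Weierstrass_m_test_ev[OF _ M]) (use bound in auto)
  then have "uniform_limit {l..u} (\<lambda>n x. \<Sum>i<n. f i x) g sequentially"
    by (rule uniform_limit_cong'[THEN iffD1, rotated -1]) (use g in \<open>auto simp: sums_iff\<close>)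
  then obtain I' J where I': "\<And>n. ((\<lambda>x. \<Sum>i<n. f i x) has_integral I' n) {l..u}"
    and J: "(g has_integral J) {l..u}" and lim: "I' \<longlonglongrightarrow> J"
    by (rule uniform_limit_integral) (auto intro!: continuous_on_sum cont)
  have "I' n = (\<Sum>i<n. I i)" for n
    using has_integral_unique[OF I' has_integral_sum[OF _ f_int]] by simp
  then have "I sums J" using lim by (metis (no_types) ext sums_def)
  then show "summable I" and "(g has_integral (\<Sum>k. I k)) {l..u}"
    using J by (auto simp: sums_iff)
qed

text \<open>Wallis recursion: the derivative of sin^(2m+1) cos is (2m+1) sin^(2m) - (2m+2)
  sin^(2m+2), and the antiderivative vanishes at both ends. The resulting ratio (2m+1)/(2m+2) is
  that of consecutive values of (1/2)_m / m!.\<close>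

lemma has_integral_sin_even_power:
  "((\<lambda>t. sin t ^ (2 * m)) has_integral pi * (pochhammer (1/2) m / fact m)) {-pi/2..pi/2}"
proof (induction m)
  case 0
  show ?case using has_integral_const_real[of "1::real" "-pi/2" "pi/2"] by simp
next
  case (Suc m)
  have "((\<lambda>t. (2 * real m + 1) * sin t ^ (2 * m) - (2 * real m + 2) * sin t ^ (2 * Suc m)) has_integral
      (sin (pi/2) ^ (2 * m + 1) * cos (pi/2) - sin (-pi/2) ^ (2 * m + 1) * cos (-pi/2))) {-pi/2..pi/2}"
  proof (rule fundamental_theorem_of_calculus)
    fix t :: real
    have "((\<lambda>t. sin t ^ (2 * m + 1) * cos t) has_real_derivative
       (2 * real m + 1) * sin t ^ (2 * m) * cos t * cos t - sin t ^ (2 * m + 1) * sin t) (at t)"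
      by (rule DERIV_cong[OF DERIV_mult[OF DERIV_power[OF DERIV_sin, of "2 * m + 1"] DERIV_cos]]) (simp add: algebra_simps)
    moreover have "cos t * cos t = 1 - sin t ^ 2"
      by (simp add: cos_squared_eq flip: power2_eq_square)
    then have "(2 * real m + 1) * sin t ^ (2 * m) * (cos t * cos t) - sin t ^ (2 * m) * sin t ^ 2
      = (2 * real m + 1) * sin t ^ (2 * m) - (2 * real m + 2) * (sin t ^ (2 * m) * sin t ^ 2)"
      by (simp only:) (simp add: algebra_simps)
    then have "(2 * real m + 1) * sin t ^ (2 * m) * cos t * cos t - sin t ^ (2 * m + 1) * sin t
      = (2 * real m + 1) * sin t ^ (2 * m) - (2 * real m + 2) * sin t ^ (2 * Suc m)"
      by (simp add: power2_eq_square mult_ac)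
    ultimately show "((\<lambda>t. sin t ^ (2 * m + 1) * cos t) has_vector_derivative
       (2 * real m + 1) * sin t ^ (2 * m) - (2 * real m + 2) * sin t ^ (2 * Suc m)) (at t within {-pi/2..pi/2})"
      by (auto simp: has_real_derivative_iff_has_vector_derivative intro: has_vector_derivative_at_within)
  qed simp
  \<comment> \<open>The power \<open>2 * Suc m\<close> is isolated as (A - (A - B)) / (2m+2), where
    A is known by induction and A - B integrates to 0.\<close>
  then have "((\<lambda>t. ((2 * real m + 1) * sin t ^ (2 * m)
        - ((2 * real m + 1) * sin t ^ (2 * m) - (2 * real m + 2) * sin t ^ (2 * Suc m))) * (1 / (2 * real m + 2)))
      has_integral ((2 * real m + 1) * (pi * (pochhammer (1/2) m / fact m)) - 0) * (1 / (2 * real m + 2))) {-pi/2..pi/2}"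
    by (intro has_integral_mult_left has_integral_diff has_integral_mult_right Suc) simp
  moreover have "((2 * real m + 1) * (pi * (pochhammer (1/2) m / fact m)) - 0) * (1 / (2 * real m + 2))
      = pi * (pochhammer (1/2) (Suc m) / fact (Suc m))"
    by (simp add: pochhammer_Suc divide_simps) (simp add: algebra_simps)
  moreover have "((2 * real m + 1) * u - ((2 * real m + 1) * u - (2 * real m + 2) * v)) * (1 / (2 * real m + 2)) = v"
    for u v :: real
    by (simp add: field_simps)
  ultimately show ?case by simp
qed

section \<open>Factorization of the general term\<close>

text \<open>All Gamma arguments are half-integers, hence neither poles nor zeros, also when p < m.
  The quotient Gamma(p - 1/2) / Gamma(p - m - 1/2) is a rising product of m factors; reversing it
  and changing signs gives the right side, which is the numerator of the binomial coefficients of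
  D^(p - 3/2).\<close>

lemma poch_int_neg_half_quotient:
  "pochhammer (-1/2) p / poch_int (-1/2) (int p - int m) = (-1) ^ m * pochhammer (3/2 - real p) m"
proof -
  have not_int: "real_of_int k - 1/2 \<noteq> of_int j" for k j :: int
  proof
    assume "real_of_int k - 1/2 = of_int j"
    then have "real_of_int (2 * k - 1) = of_int (2 * j)" by simp
    then have "2 * k - 1 = 2 * j" by (simp only: of_int_eq_iff)
    then show False by presburger
  qed
  have ni: "real_of_int k - 1/2 \<notin> \<int>\<^sub>\<le>\<^sub>0" for k
    using not_int[of k] by (auto elim!: nonpos_Ints_cases)
  have G: "Gamma (real_of_int k - 1/2) \<noteq> 0" for k
    using ni[of k] by (simp add: Gamma_eq_zero_iff)
  have "pochhammer (-1/2) p = Gamma (real p - 1/2) / Gamma (-1/2::real)"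
    using pochhammer_Gamma[of "-1/2::real" p] ni[of 0] by (simp add: algebra_simps)
  moreover have "pochhammer (real_of_int (int p - int m) - 1/2) m
      = Gamma (real p - 1/2) / Gamma (real_of_int (int p - int m) - 1/2)"
    by (subst pochhammer_Gamma[OF ni]) (simp add: algebra_simps)
  moreover have "pochhammer (real_of_int (int p - int m) - 1/2) m = (-1) ^ m * pochhammer (3/2 - real p) m"
    using pochhammer_minus'[of "real p - 3/2" m] by (simp add: algebra_simps)
  ultimately show ?thesis
    using G[of 0] by (simp add: poch_int_def)
qed

text \<open>The two products telescope. The value is the integral of s^(2k) over the unit interval,
  which is how n + p enters the series.\<close>

lemma pochhammer_half_quotient:
  "pochhammer (1/2) k / pochhammer (3/2) k = 1 / (2 * real k + 1)"
proof -
  have "pochhammer (1/2::real) k * (1/2 + real k) = 1/2 * pochhammer (3/2) k"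
    using pochhammer_Suc[of "1/2::real" k] pochhammer_rec[of "1/2::real" k] by simp
  moreover have "pochhammer (3/2::real) k > 0" by (intro pochhammer_pos) simp
  ultimately show ?thesis by (simp add: field_simps)
qed

text \<open>One of the two factors \<open>pochhammer (-1/2) p\<close> remains as a coefficient of
  the square root expansion; the other is absorbed with \<open>poch_int\<close> into the factor in m
  and p. After that no factor contains both m and n.\<close>

lemma sd_term_factorization:
  "sd_term x y w m n p =
     (pochhammer (-1/2) p / fact p * w ^ p) *
     ((pochhammer 2 n / fact n * y ^ n / (2 * real (n + p) + 1)) *
     (pochhammer (3/2 - real p) m / fact m * (-x) ^ m * (pochhammer (1/2) m / fact m)))"
proof -
  have "sd_term x y w m n p =
     (pochhammer (-1/2) p / fact p * w ^ p) *
     ((pochhammer 2 n / fact n * y ^ n * (pochhammer (1/2) (n + p) / pochhammer (3/2) (n + p))) *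
     ((pochhammer (-1/2) p / poch_int (-1/2) (int p - int m)) / fact m * x ^ m
        * (pochhammer (1/2) m / fact m)))"
    by (simp add: sd_term_def pochhammer_fact[symmetric] mult_ac)
  then show ?thesis
    unfolding poch_int_neg_half_quotient pochhammer_half_quotient by (simp add: power_minus[of x] mult_ac)
qed

section \<open>One-dimensional integrals as series in m, n and p\<close>

lemma power2_of_power: "(s ^ n)\<^sup>2 = (s\<^sup>2) ^ n" for s :: real
  by (simp add: mult.commute flip: power_mult)

text \<open>Binomial expansion in powers of x sin^2, integrated by the Wallis formula. It is applied
  with \<open>\<alpha>\<close> = 3/2 - p, which produces the sum over m.\<close>

lemma has_integral_one_plus_sin_squared_powr:
  fixes x \<alpha> :: real
  assumes "\<bar>x\<bar> < 1"
  defines "T \<equiv> (\<lambda>m. pochhammer \<alpha> m / fact m * (-x) ^ m * (pochhammer (1/2) m / fact m))"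
  shows "summable T" and "((\<lambda>t. (1 + x * (sin t)\<^sup>2) powr (-\<alpha>)) has_integral pi * suminf T) {-pi/2..pi/2}"
proof -
  let ?f = "\<lambda>m t. pochhammer \<alpha> m / fact m * (-x) ^ m * sin t ^ (2 * m)"
  let ?M = "\<lambda>m. \<bar>pochhammer \<alpha> m / fact m\<bar> * \<bar>x\<bar> ^ m"
  have sin_le: "(sin t)\<^sup>2 \<le> 1" for t :: real by (simp add: abs_square_le_1)
  have bound: "\<bar>?f m t\<bar> \<le> ?M m" for m t
  proof -
    have "\<bar>?f m t\<bar> = ?M m * ((sin t)\<^sup>2) ^ m"
      by (simp add: abs_mult power_abs power_mult)
    also have "\<dots> \<le> ?M m * 1"
      by (intro mult_left_mono power_le_one sin_le) auto
    finally show ?thesis by simp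
  qed
  have sums: "(\<lambda>m. ?f m t) sums (1 + x * (sin t)\<^sup>2) powr (-\<alpha>)" for t
  proof -
    have "\<bar>x\<bar> * (sin t)\<^sup>2 \<le> \<bar>x\<bar> * 1" by (intro mult_left_mono sin_le) auto
    then have *: "\<bar>-x * (sin t)\<^sup>2\<bar> < 1" using assms(1) by (simp add: abs_mult)
    have "?f m t = pochhammer \<alpha> m / fact m * (-x * (sin t)\<^sup>2) ^ m" for m
      by (simp only: power_mult_distrib power_mult mult.assoc)
    then show ?thesis using pochhammer_series_sums[OF *, of \<alpha>] by (simp only:) simp
  qed
  have int: "(?f m has_integral pochhammer \<alpha> m / fact m * (-x) ^ m * (pi * (pochhammer (1/2) m / fact m)))
      {-pi/2..pi/2}" for m
    by (intro has_integral_mult_right has_integral_sin_even_power)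
  have cont: "continuous_on {-pi/2..pi/2} (?f m)" for m
    by (intro continuous_intros)
  have M: "summable ?M"
    by (intro pochhammer_series_abs_summable assms(1))
  have *: "summable (\<lambda>m. pochhammer \<alpha> m / fact m * (-x) ^ m * (pi * (pochhammer (1/2) m / fact m)))"
    "((\<lambda>t. (1 + x * (sin t)\<^sup>2) powr (-\<alpha>)) has_integral
        (\<Sum>m. pochhammer \<alpha> m / fact m * (-x) ^ m * (pi * (pochhammer (1/2) m / fact m)))) {-pi/2..pi/2}"
    by (rule has_integral_sums_M_test[of _ _ ?f ?M, OF cont bound M int sums]; assumption)+
  have eq: "(\<lambda>m. pochhammer \<alpha> m / fact m * (-x) ^ m * (pi * (pochhammer (1/2) m / fact m))) = (\<lambda>m. pi * T m)"
    by (simp add: T_def fun_eq_iff)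
  show "summable T" using *(1) by (simp only: eq summable_cmult_iff) simp
  then show "((\<lambda>t. (1 + x * (sin t)\<^sup>2) powr (-\<alpha>)) has_integral pi * suminf T) {-pi/2..pi/2}"
    using *(2) unfolding eq by (simp add: suminf_mult)
qed

text \<open>The numbers (2)_n / n! are the coefficients of (1 - u)^(-2), here at u = y s^2, and each
  monomial integrates to 1 / (2(n+p)+1). This produces the sum over n.\<close>

lemma has_integral_power_over_square:
  fixes y :: real and p :: nat
  assumes y: "0 \<le> y" "y < 1"
  defines "T \<equiv> (\<lambda>n. pochhammer 2 n / fact n * y ^ n / (2 * real (n + p) + 1))"
  shows "summable T" and "((\<lambda>s. s ^ (2 * p) / (1 - y * s\<^sup>2)\<^sup>2) has_integral suminf T) {0..1}"
proof -
  let ?f = "\<lambda>n s. pochhammer 2 n / fact n * y ^ n * s ^ (2 * (n + p))"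
  let ?M = "\<lambda>n. \<bar>pochhammer 2 n / fact n\<bar> * \<bar>y\<bar> ^ n"
  have bound: "\<bar>?f n s\<bar> \<le> ?M n" if "s \<in> {0..1}" for n s
  proof -
    have "\<bar>?f n s\<bar> = ?M n * s ^ (2 * (n + p))"
      using that by (simp add: abs_mult power_abs)
    also have "\<dots> \<le> ?M n * 1"
      using that by (intro mult_left_mono power_le_one) auto
    finally show ?thesis by simp
  qed
  have sums: "(\<lambda>n. ?f n s) sums (s ^ (2 * p) / (1 - y * s\<^sup>2)\<^sup>2)" if "s \<in> {0..1}" for s
  proof -
    have "y * s\<^sup>2 \<le> y * 1" using that y by (intro mult_left_mono power_le_one) auto
    with y have "\<bar>y * s\<^sup>2\<bar> < 1" "0 < 1 - y * s\<^sup>2" by auto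
    from sums_mult[OF pochhammer_series_sums[OF this(1), of 2], of "s ^ (2 * p)"] this(2) show ?thesis
      by (simp add: power_mult_distrib power_mult power_add powr_minus divide_simps power2_of_power mult_ac)
  qed
  have int: "(?f n has_integral pochhammer 2 n / fact n * y ^ n * (1 / (2 * real (n + p) + 1))) {0..1}" for n
  proof (intro has_integral_mult_right)
    have "((\<lambda>s::real. s ^ (2 * (n + p))) has_integral 1 ^ Suc (2 * (n + p)) / real (Suc (2 * (n + p)))
        - 0 ^ Suc (2 * (n + p)) / real (Suc (2 * (n + p)))) {0..1}"
    proof (rule fundamental_theorem_of_calculus)
      show "((\<lambda>s. s ^ Suc (2 * (n + p)) / real (Suc (2 * (n + p)))) has_vector_derivative s ^ (2 * (n + p)))
          (at s within {0..1})" for s :: real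
        unfolding has_real_derivative_iff_has_vector_derivative[symmetric]
        by (rule DERIV_cong[OF DERIV_cdivide[OF DERIV_power[OF DERIV_ident]]]) (simp del: power_Suc of_nat_Suc)
    qed simp
    then show "((\<lambda>s::real. s ^ (2 * (n + p))) has_integral 1 / (2 * real (n + p) + 1)) {0..1}"
      by (simp add: add_ac)
  qed
  have cont: "continuous_on {0..1} (?f n)" for n
    by (intro continuous_intros)
  have M: "summable ?M"
    using y by (intro pochhammer_series_abs_summable) simp
  have
    "summable (\<lambda>n. pochhammer 2 n / fact n * y ^ n * (1 / (2 * real (n + p) + 1)))"
    "((\<lambda>s. s ^ (2 * p) / (1 - y * s\<^sup>2)\<^sup>2) has_integral
        (\<Sum>n. pochhammer 2 n / fact n * y ^ n * (1 / (2 * real (n + p) + 1)))) {0..1}"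
    by (rule has_integral_sums_M_test[of 0 1 ?f ?M, OF cont bound M int sums]; assumption)+
  then show "summable T" and "((\<lambda>s. s ^ (2 * p) / (1 - y * s\<^sup>2)\<^sup>2) has_integral suminf T) {0..1}"
    by (simp_all add: T_def)
qed

text \<open>The root is the binomial series with parameter -1/2 at w d s^2. The parameter d stands
  for a value of D; its bound by 1 keeps the argument inside the unit disc when |w| < 1.\<close>

lemma has_integral_sqrt_over_square:
  fixes y w d :: real and K :: "nat \<Rightarrow> real"
  assumes y: "0 \<le> y" "y < 1" and w: "\<bar>w\<bar> < 1" and d: "0 \<le> d" "d \<le> 1"
    and K: "\<And>p. ((\<lambda>s. s ^ (2 * p) / (1 - y * s\<^sup>2)\<^sup>2) has_integral K p) {0..1}"
  shows "summable (\<lambda>p. pochhammer (-1/2) p / fact p * w ^ p * d ^ p * K p)"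
    and "((\<lambda>s. sqrt (1 - w * d * s\<^sup>2) / (1 - y * s\<^sup>2)\<^sup>2) has_integral
      (\<Sum>p. pochhammer (-1/2) p / fact p * w ^ p * d ^ p * K p)) {0..1}"
proof -
  let ?f = "\<lambda>p s. pochhammer (-1/2) p / fact p * w ^ p * d ^ p * (s ^ (2 * p) / (1 - y * s\<^sup>2)\<^sup>2)"
  let ?M = "\<lambda>p. \<bar>pochhammer (-1/2) p / fact p\<bar> * \<bar>w\<bar> ^ p * (1 / (1 - y)\<^sup>2)"
  have pos: "1 - y \<le> 1 - y * s\<^sup>2" if "s \<in> {0..1}" for s
    using that y mult_left_mono[of "s\<^sup>2" 1 y] by (simp add: power_le_one)
  have bound: "\<bar>?f p s\<bar> \<le> ?M p" if s: "s \<in> {0..1}" for p s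
  proof -
    have "\<bar>?f p s\<bar> = \<bar>pochhammer (-1/2) p / fact p\<bar> * \<bar>w\<bar> ^ p * ((d ^ p * s ^ (2 * p)) * (1 / (1 - y * s\<^sup>2)\<^sup>2))"
      using s d by (simp add: abs_mult power_abs)
    also have "\<dots> \<le> \<bar>pochhammer (-1/2) p / fact p\<bar> * \<bar>w\<bar> ^ p * (1 * (1 / (1 - y)\<^sup>2))"
      using s d y pos[OF s]
      by (intro mult_left_mono mult_mono mult_le_one power_le_one divide_left_mono power_mono mult_pos_pos) auto
    finally show ?thesis by simp
  qed
  have sums: "(\<lambda>p. ?f p s) sums (sqrt (1 - w * d * s\<^sup>2) / (1 - y * s\<^sup>2)\<^sup>2)" if s: "s \<in> {0..1}" for s
  proof -
    have "\<bar>w\<bar> * (d * s\<^sup>2) \<le> \<bar>w\<bar> * 1"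
      using s d by (intro mult_left_mono mult_le_one power_le_one) auto
    then have *: "\<bar>w * d * s\<^sup>2\<bar> < 1" using w d by (simp add: abs_mult mult.assoc)
    then have "(1 - w * d * s\<^sup>2) powr (-(-1/2)) = sqrt (1 - w * d * s\<^sup>2)"
      by (simp add: powr_half_sqrt)
    with sums_divide[OF pochhammer_series_sums[OF *, of "-1/2"], of "(1 - y * s\<^sup>2)\<^sup>2"] show ?thesis
      by (simp add: power_mult_distrib power_mult power2_of_power mult_ac)
  qed
  have cont: "continuous_on {0..1} (?f p)" for p
    using pos y by (intro continuous_intros) fastforce
  have int: "(?f p has_integral pochhammer (-1/2) p / fact p * w ^ p * d ^ p * K p) {0..1}" for p
    by (intro has_integral_mult_right K)
  have M: "summable ?M"
    by (intro summable_mult2 pochhammer_series_abs_summable w)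
  show "summable (\<lambda>p. pochhammer (-1/2) p / fact p * w ^ p * d ^ p * K p)"
    and "((\<lambda>s. sqrt (1 - w * d * s\<^sup>2) / (1 - y * s\<^sup>2)\<^sup>2) has_integral
      (\<Sum>p. pochhammer (-1/2) p / fact p * w ^ p * d ^ p * K p)) {0..1}"
    by (rule has_integral_sums_M_test[of 0 1 ?f ?M, OF cont bound M int sums]; assumption)+
qed

text \<open>The expansion in p is repeated under the angular integral, where d = D(t) turns d^p
  D^(-3/2) into D^(p - 3/2). The inner integrals enter only through their values \<open>K\<close>,
  \<open>F\<close> and \<open>J\<close>, so a single sum over p has to be controlled.\<close>

lemma has_integral_angular_series:
  fixes x y w :: real and K F :: "nat \<Rightarrow> real" and J :: "real \<Rightarrow> real"
  defines "D \<equiv> (\<lambda>t. 1 + x * (sin t)\<^sup>2)"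
  assumes x: "-1 < x" "x \<le> 0" and y: "0 \<le> y" "y < 1" and w: "\<bar>w\<bar> < 1"
    and K: "\<And>p. ((\<lambda>s. s ^ (2 * p) / (1 - y * s\<^sup>2)\<^sup>2) has_integral K p) {0..1}"
    and F: "\<And>p::nat. ((\<lambda>t. D t powr (-(3/2 - real p))) has_integral pi * F p) {-pi/2..pi/2}"
    and J: "\<And>d. 0 \<le> d \<Longrightarrow> d \<le> 1 \<Longrightarrow>
      ((\<lambda>s. sqrt (1 - w * d * s\<^sup>2) / (1 - y * s\<^sup>2)\<^sup>2) has_integral J d) {0..1}"
  shows "summable (\<lambda>p. pochhammer (-1/2) p / fact p * w ^ p * (K p * F p))"
    and "((\<lambda>t. D t powr (-3/2) * J (D t)) has_integral
      pi * (\<Sum>p. pochhammer (-1/2) p / fact p * w ^ p * (K p * F p))) {-pi/2..pi/2}"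
proof -
  let ?S = "{-pi/2..pi/2::real}"
  let ?f = "\<lambda>p::nat. \<lambda>t. pochhammer (-1/2) p / fact p * w ^ p * K p * D t powr (-(3/2 - real p))"
  \<comment> \<open>As 0 < 1 + x <= D <= 1, the power D^(p - 3/2) = D^(-3/2) D^p is at most (1 +
    x)^(-3/2) for all p. Likewise \<open>K p\<close> is bounded uniformly in p.\<close>
  let ?M = "\<lambda>p. \<bar>pochhammer (-1/2) p / fact p\<bar> * \<bar>w\<bar> ^ p * (1 / (1 - y)\<^sup>2 * (1 + x) powr (-3/2))"
  have D: "1 + x \<le> D t" "D t \<le> 1" "0 < D t" for t
  proof -
    have "- x * (sin t)\<^sup>2 \<le> - x * 1"
      using x by (intro mult_left_mono) (auto simp: abs_square_le_1)
    then show "1 + x \<le> D t" by (simp add: D_def)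
    with x show "0 < D t" by simp
    show "D t \<le> 1" using x by (simp add: D_def mult_nonpos_nonneg)
  qed
  have K_bound: "\<bar>K p\<bar> \<le> 1 / (1 - y)\<^sup>2" for p
  proof -
    have "0 \<le> K p" by (rule has_integral_nonneg[OF K]) auto
    moreover have "K p \<le> 1 / (1 - y)\<^sup>2"
    proof (rule has_integral_le[OF K])
      show "((\<lambda>s::real. 1 / (1 - y)\<^sup>2) has_integral 1 / (1 - y)\<^sup>2) {0..1}"
        using has_integral_const_real[of "1 / (1 - y)\<^sup>2" 0 1] by simp
      show "s ^ (2 * p) / (1 - y * s\<^sup>2)\<^sup>2 \<le> 1 / (1 - y)\<^sup>2" if "s \<in> {0..1}" for s
      proof -
        have "y * s\<^sup>2 \<le> y * 1" using that y by (intro mult_left_mono power_le_one) auto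
        then show ?thesis using that y by (intro frac_le power_le_one power_mono) auto
      qed
    qed
    ultimately show ?thesis by simp
  qed
  have powr_split: "D t powr (-(3/2 - real p)) = D t powr (-3/2) * D t ^ p" for t and p :: nat
    using D(3)[of t] by (simp add: powr_realpow[symmetric] flip: powr_add)
  have bound: "\<bar>?f p t\<bar> \<le> ?M p" for p t
  proof -
    have "D t powr (-3/2) \<le> (1 + x) powr (-3/2)"
      using D[of t] x by (intro powr_mono2') auto
    then have *: "D t powr (-3/2) * D t ^ p \<le> (1 + x) powr (-3/2) * 1"
      using D[of t] by (intro mult_mono power_le_one) auto
    have "\<bar>K p\<bar> * (D t powr (-3/2) * D t ^ p) \<le> 1 / (1 - y)\<^sup>2 * ((1 + x) powr (-3/2) * 1)"
      using D(3)[of t] by (intro mult_mono[OF K_bound *]) auto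
    then have "\<bar>pochhammer (-1/2) p / fact p\<bar> * \<bar>w\<bar> ^ p * (\<bar>K p\<bar> * (D t powr (-3/2) * D t ^ p))
        \<le> \<bar>pochhammer (-1/2) p / fact p\<bar> * \<bar>w\<bar> ^ p * (1 / (1 - y)\<^sup>2 * ((1 + x) powr (-3/2) * 1))"
      by (intro mult_left_mono) auto
    moreover have "\<bar>?f p t\<bar> = \<bar>pochhammer (-1/2) p / fact p\<bar> * \<bar>w\<bar> ^ p * (\<bar>K p\<bar> * (D t powr (-3/2) * D t ^ p))"
      using D(3)[of t] unfolding powr_split by (simp add: abs_mult power_abs)
    ultimately show ?thesis by simp
  qed
  have M: "summable ?M"
    by (intro summable_mult2 pochhammer_series_abs_summable w)
  have cont: "continuous_on ?S (?f p)" for p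
    using D(3) unfolding D_def by (intro continuous_intros) (metis less_irrefl)
  have int: "(?f p has_integral pochhammer (-1/2) p / fact p * w ^ p * K p * (pi * F p)) ?S" for p
    by (intro has_integral_mult_right F)
  have sums: "(\<lambda>p. ?f p t) sums (D t powr (-3/2) * J (D t))" for t
  proof -
    have d: "0 \<le> D t" "D t \<le> 1" using D[of t] by auto
    have "(\<lambda>p. pochhammer (-1/2) p / fact p * w ^ p * D t ^ p * K p) sums J (D t)"
      \<comment> \<open>\<open>J\<close> is known only as the value of an integral; uniqueness of
        that value identifies it with the series.\<close>
      using has_integral_unique[OF has_integral_sqrt_over_square(2)[OF y w d K] J[OF d]]
        has_integral_sqrt_over_square(1)[OF y w d K] by (simp only: sums_iff)
    from sums_mult[OF this, of "D t powr (-3/2)"] show ?thesis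
      unfolding powr_split by (simp add: mult_ac)
  qed
  have *: "summable (\<lambda>p. pochhammer (-1/2) p / fact p * w ^ p * K p * (pi * F p))"
    "((\<lambda>t. D t powr (-3/2) * J (D t)) has_integral
      (\<Sum>p. pochhammer (-1/2) p / fact p * w ^ p * K p * (pi * F p))) ?S"
    by (rule has_integral_sums_M_test[of _ _ ?f ?M, OF cont bound M int sums]; assumption)+
  have eq: "(\<lambda>p. pochhammer (-1/2) p / fact p * w ^ p * K p * (pi * F p))
      = (\<lambda>p. pi * (pochhammer (-1/2) p / fact p * w ^ p * (K p * F p)))"
    by (simp add: fun_eq_iff)
  show "summable (\<lambda>p. pochhammer (-1/2) p / fact p * w ^ p * (K p * F p))"
    using *(1) by (simp only: eq summable_cmult_iff) simp
  then show "((\<lambda>t. D t powr (-3/2) * J (D t)) has_integral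
      pi * (\<Sum>p. pochhammer (-1/2) p / fact p * w ^ p * (K p * F p))) ?S"
    using *(2) unfolding eq by (simp only: suminf_mult)
qed

section \<open>Substitutions in nonnegative integrals\<close>

text \<open>For each x other than 0 the line y = x t is an affine substitution with Jacobian |x|;
  the slice x = 0 is null. Tonelli then makes the slope the outer variable.\<close>

lemma nn_integral_slope_coordinates:
  fixes h :: "real \<times> real \<Rightarrow> ennreal"
  assumes [measurable]: "h \<in> borel_measurable borel"
  shows "(\<integral>\<^sup>+p. h p \<partial>lborel) = (\<integral>\<^sup>+t. \<integral>\<^sup>+x. ennreal \<bar>x\<bar> * h (x, x * t) \<partial>lborel \<partial>lborel)"
proof -
  have [measurable]: "h \<in> borel_measurable (borel \<Otimes>\<^sub>M borel)"
    unfolding borel_prod by (rule assms)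
  have "(\<integral>\<^sup>+p. h p \<partial>lborel) = (\<integral>\<^sup>+x. \<integral>\<^sup>+y. h (x, y) \<partial>lborel \<partial>lborel)"
    by (subst lborel.nn_integral_fst) (simp_all add: lborel_prod)
  also have "\<dots> = (\<integral>\<^sup>+x. \<integral>\<^sup>+t. ennreal \<bar>x\<bar> * h (x, x * t) \<partial>lborel \<partial>lborel)"
  proof (rule nn_integral_cong_AE)
    have slice: "(\<integral>\<^sup>+y. h (x, y) \<partial>lborel) = (\<integral>\<^sup>+t. ennreal \<bar>x\<bar> * h (x, x * t) \<partial>lborel)" if "x \<noteq> 0" for x
      by (subst nn_integral_real_affine[OF _ that, of _ 0]) (simp_all add: nn_integral_cmult)
    show "AE x in lborel. (\<integral>\<^sup>+y. h (x, y) \<partial>lborel) = (\<integral>\<^sup>+t. ennreal \<bar>x\<bar> * h (x, x * t) \<partial>lborel)"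
      using AE_lborel_singleton[of 0] by eventually_elim (rule slice)
  qed
  also have "\<dots> = (\<integral>\<^sup>+t. \<integral>\<^sup>+x. ennreal \<bar>x\<bar> * h (x, x * t) \<partial>lborel \<partial>lborel)"
    by (rule lborel_pair.Fubini'[symmetric]) measurable
  finally show ?thesis .
qed

lemma nn_integral_even:
  fixes f :: "real \<Rightarrow> ennreal"
  assumes [measurable]: "f \<in> borel_measurable borel" and even: "\<And>x. f (-x) = f x"
  shows "(\<integral>\<^sup>+x. f x \<partial>lborel) = 2 * (\<integral>\<^sup>+x. f x * indicator {0<..} x \<partial>lborel)"
proof -
  have "(\<integral>\<^sup>+x. f x \<partial>lborel) = (\<integral>\<^sup>+x. f x * indicator {0<..} x + f x * indicator {..<0} x \<partial>lborel)"
  proof (rule nn_integral_cong_AE)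
    show "AE x in lborel. f x = f x * indicator {0<..} x + f x * indicator {..<0} x"
      using AE_lborel_singleton[of 0] by eventually_elim (auto split: split_indicator)
  qed
  also have "\<dots> = (\<integral>\<^sup>+x. f x * indicator {0<..} x \<partial>lborel) + (\<integral>\<^sup>+x. f x * indicator {..<0} x \<partial>lborel)"
    by (rule nn_integral_add) measurable
  also have "(\<integral>\<^sup>+x. f x * indicator {..<0} x \<partial>lborel) = (\<integral>\<^sup>+x. f x * indicator {0<..} x \<partial>lborel)"
    by (subst nn_integral_real_affine[of _ "-1" 0])
      (auto simp: even intro!: nn_integral_cong split: split_indicator)
  finally show ?thesis by (simp add: mult_2)
qed

text \<open>The tangent maps the open interval bijectively onto the line. Since \<open>g\<close> has
  to match the transformed integrand only in the interior, it may be a function continuous up to the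
  endpoints, where the tangent blows up. Nonnegativity turns the gauge integral into an absolute one
  and back.\<close>

lemma nn_integral_tan_substitution:
  fixes f :: "real \<Rightarrow> real" and k :: real
  assumes nonneg: "\<And>t. 0 \<le> f t" and k: "k > 0"
    and I: "(g has_integral I) {-pi/2..pi/2}"
    and g: "\<And>\<phi>. -pi/2 < \<phi> \<Longrightarrow> \<phi> < pi/2 \<Longrightarrow> g \<phi> = k / (cos \<phi>)\<^sup>2 * f (k * tan \<phi>)"
  shows "(\<integral>\<^sup>+t. ennreal (f t) \<partial>lborel) = ennreal I"
proof -
  let ?S = "{-pi/2<..<pi/2}" and ?h = "\<lambda>\<phi>. k * tan \<phi>" and ?h' = "\<lambda>\<phi>. k / (cos \<phi>)\<^sup>2"
  have "(g has_integral I) ?S"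
    using I by (simp add: has_integral_Icc_iff_Ioo)
  then have int: "((\<lambda>\<phi>. \<bar>?h' \<phi>\<bar> * f (?h \<phi>)) has_integral I) ?S"
    by (rule has_integral_eq[rotated]) (use k in \<open>auto simp: g\<close>)
  have "cos \<phi> > 0" if "\<phi> \<in> ?S" for \<phi>
    using that by (intro cos_gt_zero_pi) auto
  then have der: "(?h has_field_derivative ?h' \<phi>) (at \<phi> within ?S)" if "\<phi> \<in> ?S" for \<phi>
    using that by (auto intro!: derivative_eq_intros simp: field_simps) fastforce
  have inj: "inj_on ?h ?S"
  proof (rule inj_onI)
    fix u v assume uv: "u \<in> ?S" "v \<in> ?S" and "k * tan u = k * tan v"
    then have "arctan (tan u) = arctan (tan v)" using k by simp
    then show "u = v" using uv by (simp add: arctan_tan)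
  qed
  have "?h ` ?S = UNIV"
  proof -
    have "t = ?h (arctan (t / k))" "arctan (t / k) \<in> ?S" for t
      using k arctan_bounded[of "t / k"] by (auto simp: tan_arctan)
    then show ?thesis by blast
  qed
  moreover have "(\<lambda>\<phi>. \<bar>?h' \<phi>\<bar> * f (?h \<phi>)) absolutely_integrable_on ?S \<and>
      integral ?S (\<lambda>\<phi>. \<bar>?h' \<phi>\<bar> * f (?h \<phi>)) = I"
    using int nonneg by (auto intro!: nonnegative_absolutely_integrable_1 simp: has_integral_iff)
  ultimately have "f absolutely_integrable_on UNIV" "integral UNIV f = I"
    using has_absolute_integral_change_of_variables_1'[OF _ der inj, of f I] by auto
  then have "(f has_integral I) UNIV"
    by (auto simp: has_integral_iff absolutely_integrable_on_def)
  from nn_integral_has_integral_lebesgue'[OF _ this] nonneg show ?thesis by simp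
qed

text \<open>Along a line of slope t the point s = 0 is on the inner ellipse and s = 1 on the outer
  one. The root blows up like 1/s at s = 0, and the Jacobian of q x^2 = 1 / (1 - y s^2) carries the
  factor s that cancels this.\<close>

lemma nn_integral_radial:
  fixes q e y j :: real
  assumes q: "q > 0" and e: "e > 0" and y: "0 < y" "y < 1"
    and j: "((\<lambda>s. sqrt (1 + q * y / e * s\<^sup>2) / (1 - y * s\<^sup>2)\<^sup>2) has_integral j) {0..1}"
  shows "(\<integral>\<^sup>+x. ennreal (x * sqrt (1 + e * x\<^sup>2 / (q * x\<^sup>2 - 1))
            * indicator {1 / sqrt q..1 / sqrt (q * (1 - y))} x) \<partial>lborel)
       = ennreal (sqrt y / q * sqrt (e / q) * j)"
proof -
  let ?f = "\<lambda>x. x * sqrt (1 + e * x\<^sup>2 / (q * x\<^sup>2 - 1))"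
  let ?g = "\<lambda>s. 1 / sqrt (q * (1 - y * s\<^sup>2))"
  let ?g' = "\<lambda>s. q * y * s / ((q * (1 - y * s\<^sup>2)) * sqrt (q * (1 - y * s\<^sup>2)))"
  let ?F = "\<lambda>s. sqrt y / q * sqrt (e / q) * (sqrt (1 + q * y / e * s\<^sup>2) / (1 - y * s\<^sup>2)\<^sup>2)"
  have r: "0 < 1 - y * s\<^sup>2" if "s \<in> {0..1}" for s
  proof -
    have "y * s\<^sup>2 \<le> y * 1" using that y by (intro mult_left_mono power_le_one) auto
    with y show ?thesis by linarith
  qed
  have meas: "set_borel_measurable borel {?g 0..?g 1} ?f"
    unfolding set_borel_measurable_def by measurable
  have der: "(?g has_real_derivative ?g' s) (at s)" if s: "s \<in> {0..1}" for s
  proof -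
    define R where "R = q * (1 - y * s\<^sup>2)"
    have R: "R > 0" using r[OF s] q by (simp add: R_def)
    have "((\<lambda>s. q * (1 - y * s\<^sup>2)) has_real_derivative - (2 * q * y * s)) (at s)"
      by (auto intro!: derivative_eq_intros)
    from DERIV_divide[OF DERIV_const DERIV_chain2[OF DERIV_real_sqrt this], of 1] R[unfolded R_def]
    have "(?g has_real_derivative (0 * sqrt R - 1 * (inverse (sqrt R) / 2 * - (2 * q * y * s)))
        / (sqrt R * sqrt R)) (at s)"
      unfolding R_def by fastforce
    moreover have "(0 * sqrt R - 1 * (inverse (sqrt R) / 2 * - (2 * q * y * s))) / (sqrt R * sqrt R)
        = q * y * s / (R * sqrt R)"
    proof -
      have "sqrt R * sqrt R = R" using R by simp
      then show ?thesis using R by (simp only:) (simp add: inverse_eq_divide mult.commute)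
    qed
    ultimately show ?thesis by (simp only: R_def)
  qed
  have nz: "q * (1 - y * s\<^sup>2) * sqrt (q * (1 - y * s\<^sup>2)) \<noteq> 0" if "s \<in> {0..1}" for s
    using r[OF that] q by (metis less_irrefl mult_pos_pos real_sqrt_gt_zero)
  have cont: "continuous_on {0..1} ?g'"
    by (rule continuous_on_divide) (use nz in \<open>auto intro!: continuous_intros\<close>)
  have "(\<integral>\<^sup>+x. ennreal (?f x * indicator {1 / sqrt q..1 / sqrt (q * (1 - y))} x) \<partial>lborel)
      = (\<integral>\<^sup>+s. ennreal (?f (?g s) * ?g' s * indicator {0..1} s) \<partial>lborel)"
    using nn_integral_substitution[OF meas der cont] r q y by (simp add: less_imp_le)
  also have "\<dots> = (\<integral>\<^sup>+s. ennreal (?F s) * indicator {0..1} s \<partial>lborel)"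
  proof (rule nn_integral_cong_AE)
    \<comment> \<open>At \<open>s = 0\<close> the left integrand is 0 (zero Jacobian times a junk quotient by 0); the right one is positive.\<close>
    have AE_eq: "AE s in lborel. ennreal (u s * indicator {0..1} s) = ennreal (v s) * indicator {0..1} s"
      if "\<And>s. s \<in> {0..1} \<Longrightarrow> s \<noteq> 0 \<Longrightarrow> u s = v s" for u v :: "real \<Rightarrow> real"
      using AE_lborel_singleton[of 0] by eventually_elim (auto simp: indicator_def that)
    have "?f (?g s) * ?g' s = ?F s" if s: "s \<in> {0..1}" "s \<noteq> 0" for s
    proof -
      define r where "r = 1 - y * s\<^sup>2"
      have pos: "r > 0" "s > 0" using r s by (auto simp: r_def)
      have sq: "(?g s)\<^sup>2 = 1 / (q * r)"
        using pos q by (simp add: power_divide r_def)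
      \<comment> \<open>The vanishing denominator becomes a perfect square in s up to regular
        factors, so its root is linear in s.\<close>
      have den: "q * (?g s)\<^sup>2 - 1 = y * s\<^sup>2 / r"
        unfolding sq using pos q by (simp add: field_simps) (simp add: r_def)
      have "1 + e * (?g s)\<^sup>2 / (q * (?g s)\<^sup>2 - 1) = (e / q) * (1 + q * y / e * s\<^sup>2) / (y * s\<^sup>2)"
        unfolding den unfolding sq using pos q y e by (simp add: field_simps)
      then have sqrt_eq: "sqrt (1 + e * (?g s)\<^sup>2 / (q * (?g s)\<^sup>2 - 1))
          = sqrt (e / q) * sqrt (1 + q * y / e * s\<^sup>2) / (sqrt y * s)"
        using pos by (simp only: real_sqrt_divide real_sqrt_mult real_sqrt_abs abs_of_pos)
      have jac_eq: "?g s * ?g' s = y * s / (q * r\<^sup>2)"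
      proof -
        have "?g s * ?g' s = y * s * (?g s)\<^sup>2 / r"
          using pos q by (simp add: r_def power2_eq_square)
        also have "\<dots> = y * s / (q * r\<^sup>2)"
          unfolding sq by (simp add: power2_eq_square)
        finally show ?thesis .
      qed
      have "?f (?g s) * ?g' s = (?g s * ?g' s) * sqrt (1 + e * (?g s)\<^sup>2 / (q * (?g s)\<^sup>2 - 1))"
        by (simp only: mult_ac)
      also have "\<dots> = (y * s / (q * r\<^sup>2)) *
          (sqrt (e / q) * sqrt (1 + q * y / e * s\<^sup>2) / (sqrt y * s))"
        by (simp only: sqrt_eq jac_eq)
      also have "\<dots> = (y / sqrt y) / q * sqrt (e / q) * (sqrt (1 + q * y / e * s\<^sup>2) / r\<^sup>2)"
        using pos by (simp add: mult_ac)
      also have "y / sqrt y = sqrt y"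
        using y by (simp add: real_div_sqrt)
      finally show ?thesis by (simp only: r_def)
    qed
    then show "AE s in lborel. ennreal (?f (?g s) * ?g' s * indicator {0..1} s) = ennreal (?F s) * indicator {0..1} s"
      by (rule AE_eq)
  qed
  also have "\<dots> = ennreal (sqrt y / q * sqrt (e / q) * j)"
    using q e y by (intro nn_integral_has_integral_lebesgue' has_integral_mult_right j) auto
  finally show ?thesis .
qed

section \<open>The area as an angular integral\<close>

text \<open>The three substitutions are chained: slope coordinates, then the radial one for fixed
  slope, then the tangent. The outer bound \<open>1 / (1 - y)\<close> is the square of lambda, and
  \<open>J\<close> and \<open>I\<close> carry the values of the inner and outer integrals.\<close>

lemma nn_integral_hyperboloid_area:
  fixes a b c y I :: real and J :: "real \<Rightarrow> real"
  defines "D \<equiv> (\<lambda>\<phi>. 1 + (b\<^sup>2 / a\<^sup>2 - 1) * (sin \<phi>)\<^sup>2)"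
    and "f \<equiv> (\<lambda>p. sqrt (1 + c\<^sup>2 * ((fst p)\<^sup>2 / a ^ 4 + (snd p)\<^sup>2 / b ^ 4) /
        ((fst p)\<^sup>2 / a\<^sup>2 + (snd p)\<^sup>2 / b\<^sup>2 - 1)))"
    and "S \<equiv> {p. 1 \<le> (fst p)\<^sup>2 / a\<^sup>2 + (snd p)\<^sup>2 / b\<^sup>2 \<and> (fst p)\<^sup>2 / a\<^sup>2 + (snd p)\<^sup>2 / b\<^sup>2 \<le> 1 / (1 - y)}"
  assumes ab: "b \<le> a" "b > 0" and c: "c > 0" and y: "0 < y" "y < 1"
    and J: "\<And>d. 0 \<le> d \<Longrightarrow> d \<le> 1 \<Longrightarrow>
      ((\<lambda>s. sqrt (1 - (- (a\<^sup>2 * y / c\<^sup>2)) * d * s\<^sup>2) / (1 - y * s\<^sup>2)\<^sup>2) has_integral J d) {0..1}"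
    and I: "((\<lambda>\<phi>. D \<phi> powr (-3/2) * J (D \<phi>)) has_integral I) {-pi/2..pi/2}"
  shows "(\<integral>\<^sup>+p. ennreal (f p * indicator S p) \<partial>lborel) = ennreal (2 * b\<^sup>2 * c * sqrt y / a * I)"
proof -
  have a: "a > 0" using ab by simp
  define q where "q = (\<lambda>t. 1 / a\<^sup>2 + t\<^sup>2 / b\<^sup>2)"
  define e where "e = (\<lambda>t. c\<^sup>2 * (1 / a ^ 4 + t\<^sup>2 / b ^ 4))"
  \<comment> \<open>Chosen so that q y / e = (a^2 y / c^2) d, which gives the radial integral the
    form assumed for \<open>J\<close>.\<close>
  define d where "d = (\<lambda>t. q t * c\<^sup>2 / (a\<^sup>2 * e t))"
  \<comment> \<open>The factor 2 accounts for the half-plane x < 0.\<close>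
  define F where "F = (\<lambda>t. 2 * (sqrt y / q t * sqrt (e t / q t) * J (d t)))"
  have q: "q t > 0" and e: "e t > 0" for t
    using a ab c by (simp_all add: q_def e_def add_pos_nonneg)
  have d: "0 \<le> d t" "d t \<le> 1" for t
  proof -
    show "0 \<le> d t" using q[of t] e[of t] by (simp add: d_def)
    \<comment> \<open>This is where \<open>b \<le> a\<close> keeps \<open>d t\<close> in the unit
      interval.\<close>
    have "t\<^sup>2 / b\<^sup>2 * 1 \<le> t\<^sup>2 / b\<^sup>2 * (a\<^sup>2 / b\<^sup>2)"
      using ab by (intro mult_left_mono) (auto intro!: power_mono)
    also have "\<dots> = a\<^sup>2 * (t\<^sup>2 / b ^ 4)" by (simp add: field_simps)
    finally have "t\<^sup>2 / b\<^sup>2 \<le> a\<^sup>2 * (t\<^sup>2 / b ^ 4)" by simp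
    moreover have "a\<^sup>2 * (1 / a ^ 4) = 1 / a\<^sup>2"
      using a by (simp add: power4_eq_xxxx power2_eq_square)
    ultimately have "q t \<le> a\<^sup>2 * (1 / a ^ 4 + t\<^sup>2 / b ^ 4)"
      unfolding q_def distrib_left by simp
    then have "c\<^sup>2 * q t \<le> c\<^sup>2 * (a\<^sup>2 * (1 / a ^ 4 + t\<^sup>2 / b ^ 4))"
      by (rule mult_left_mono) simp
    also have "\<dots> = a\<^sup>2 * e t" by (simp add: e_def)
    finally show "d t \<le> 1" using a e[of t] by (simp add: d_def mult.commute)
  qed
  have meas [measurable]: "(\<lambda>p. ennreal (f p * indicator S p)) \<in> borel_measurable borel"
  proof -
    have "(\<lambda>p. ennreal (f p * indicator S p)) \<in> borel_measurable (borel \<Otimes>\<^sub>M borel)"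
      unfolding f_def S_def by measurable
    then show ?thesis by (simp only: borel_prod)
  qed
  have inner: "(\<integral>\<^sup>+x. ennreal \<bar>x\<bar> * ennreal (f (x, x * t) * indicator S (x, x * t)) \<partial>lborel) = ennreal (F t)" for t
  proof -
    have [measurable]: "(\<lambda>x. ennreal (f (x, x * t) * indicator S (x, x * t))) \<in> borel_measurable borel"
      by (rule measurable_compose[OF _ meas, of "\<lambda>x. (x, x * t)"]) (unfold borel_prod[symmetric], measurable)
    have meas': "(\<lambda>x. ennreal \<bar>x\<bar> * ennreal (f (x, x * t) * indicator S (x, x * t))) \<in> borel_measurable borel"
      by measurable
    have "(\<integral>\<^sup>+x. ennreal \<bar>x\<bar> * ennreal (f (x, x * t) * indicator S (x, x * t)) \<partial>lborel)
        = 2 * (\<integral>\<^sup>+x. ennreal \<bar>x\<bar> * ennreal (f (x, x * t) * indicator S (x, x * t)) * indicator {0<..} x \<partial>lborel)"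
      by (rule nn_integral_even[OF meas']) (simp add: f_def S_def indicator_def)
    also have "(\<integral>\<^sup>+x. ennreal \<bar>x\<bar> * ennreal (f (x, x * t) * indicator S (x, x * t)) * indicator {0<..} x \<partial>lborel)
      = (\<integral>\<^sup>+x. ennreal (x * sqrt (1 + e t * x\<^sup>2 / (q t * x\<^sup>2 - 1))
            * indicator {1 / sqrt (q t)..1 / sqrt (q t * (1 - y))} x) \<partial>lborel)"
    proof (rule nn_integral_cong)
      fix x :: real
      show "ennreal \<bar>x\<bar> * ennreal (f (x, x * t) * indicator S (x, x * t)) * indicator {0<..} x
        = ennreal (x * sqrt (1 + e t * x\<^sup>2 / (q t * x\<^sup>2 - 1))
            * indicator {1 / sqrt (q t)..1 / sqrt (q t * (1 - y))} x)"
      proof (cases "x > 0")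
        case False
        moreover have "1 / sqrt (q t) > 0" using q[of t] by simp
        ultimately have "\<not> 1 / sqrt (q t) \<le> x" by linarith
        with False show ?thesis by (auto simp: indicator_def)
      next
        case True
        \<comment> \<open>Used at k = q t for the inner ellipse and at k = q t (1 - y) for the outer
          one.\<close>
        have ge: "1 / sqrt k \<le> x \<longleftrightarrow> 1 \<le> k * x\<^sup>2" and le: "x \<le> 1 / sqrt k \<longleftrightarrow> k * x\<^sup>2 \<le> 1"
          if "k > 0" for k
        proof -
          have "sqrt (k * x\<^sup>2) = sqrt k * x" using True by (simp add: real_sqrt_mult)
          then have sqrt_iff: "1 \<le> k * x\<^sup>2 \<longleftrightarrow> 1 \<le> sqrt k * x" "k * x\<^sup>2 \<le> 1 \<longleftrightarrow> sqrt k * x \<le> 1"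
            using real_sqrt_ge_1_iff[of "k * x\<^sup>2"] real_sqrt_le_1_iff[of "k * x\<^sup>2"] by simp_all
          have "sqrt k > 0" using that by simp
          then show "1 / sqrt k \<le> x \<longleftrightarrow> 1 \<le> k * x\<^sup>2" "x \<le> 1 / sqrt k \<longleftrightarrow> k * x\<^sup>2 \<le> 1"
            unfolding sqrt_iff by (simp_all add: pos_divide_le_eq pos_le_divide_eq mult.commute)
        qed
        have qx: "x\<^sup>2 / a\<^sup>2 + (x * t)\<^sup>2 / b\<^sup>2 = q t * x\<^sup>2"
          by (simp add: q_def power_mult_distrib algebra_simps)
        have ex: "c\<^sup>2 * (x\<^sup>2 / a ^ 4 + (x * t)\<^sup>2 / b ^ 4) = e t * x\<^sup>2"
          by (simp add: e_def power_mult_distrib algebra_simps)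
        have "(x, x * t) \<in> S \<longleftrightarrow> x \<in> {1 / sqrt (q t)..1 / sqrt (q t * (1 - y))}"
        proof -
          have "q t * x\<^sup>2 \<le> 1 / (1 - y) \<longleftrightarrow> q t * (1 - y) * x\<^sup>2 \<le> 1"
            using y by (simp add: pos_le_divide_eq mult_ac)
          then show ?thesis
            using ge[of "q t"] le[of "q t * (1 - y)"] q[of t] y by (simp add: S_def qx)
        qed
        then show ?thesis
          using True by (simp add: f_def qx ex indicator_def flip: ennreal_mult')
      qed
    qed
    also have "\<dots> = ennreal (sqrt y / q t * sqrt (e t / q t) * J (d t))"
    proof (rule nn_integral_radial[OF q e y])
      have "- (- (a\<^sup>2 * y / c\<^sup>2)) * d t = q t * y / e t"
        using a c e[of t] by (simp add: d_def)
      then show "((\<lambda>s. sqrt (1 + q t * y / e t * s\<^sup>2) / (1 - y * s\<^sup>2)\<^sup>2) has_integral J (d t)) {0..1}"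
        using J[OF d, of t] by simp
    qed
    finally show ?thesis by (simp only: F_def ennreal_mult'[of 2] ennreal_numeral zero_le_numeral)
  qed
  have "(\<integral>\<^sup>+p. ennreal (f p * indicator S p) \<partial>lborel) = (\<integral>\<^sup>+t. ennreal (F t) \<partial>lborel)"
    unfolding nn_integral_slope_coordinates[OF meas] inner ..
  also have "\<dots> = ennreal (2 * b\<^sup>2 * c * sqrt y / a * I)"
  proof (rule nn_integral_tan_substitution)
    have "0 \<le> J (d t)" for t
      by (rule has_integral_nonneg[OF J[OF d]]) (use a c y d[of t] in auto)
    then show "0 \<le> F t" for t
      using q[of t] e[of t] y by (simp add: F_def)
    show "b\<^sup>2 / a\<^sup>2 > 0" using a ab by simp
    show "((\<lambda>\<phi>. 2 * b\<^sup>2 * c * sqrt y / a * (D \<phi> powr (-3/2) * J (D \<phi>))) has_integral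
        2 * b\<^sup>2 * c * sqrt y / a * I) {-pi/2..pi/2}"
      by (intro has_integral_mult_right I)
    fix \<phi> :: real
    assume \<phi>: "-pi/2 < \<phi>" "\<phi> < pi/2"
    \<comment> \<open>With this scale T^2 / b^4 = tan^2 / a^4, so \<open>e T\<close> is a multiple
      of 1 + tan^2 = 1 / cos^2 and \<open>d T\<close> reduces to \<open>D \<phi>\<close>.\<close>
    define T where "T = b\<^sup>2 / a\<^sup>2 * tan \<phi>"
    have C: "cos \<phi> > 0" using \<phi> by (intro cos_gt_zero_pi) auto
    have q_eq: "q T = D \<phi> / (a\<^sup>2 * (cos \<phi>)\<^sup>2)"
    proof -
      have "q T = ((cos \<phi>)\<^sup>2 + b\<^sup>2 / a\<^sup>2 * (sin \<phi>)\<^sup>2) / (a\<^sup>2 * (cos \<phi>)\<^sup>2)"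
        using a ab C by (simp add: T_def q_def tan_def power_mult_distrib power_divide field_simps power4_eq_xxxx power2_eq_square)
      also have "(cos \<phi>)\<^sup>2 + b\<^sup>2 / a\<^sup>2 * (sin \<phi>)\<^sup>2 = D \<phi>"
        by (simp add: D_def cos_squared_eq algebra_simps)
      finally show ?thesis .
    qed
    have e_eq: "e T = c\<^sup>2 / (a ^ 4 * (cos \<phi>)\<^sup>2)"
    proof -
      have "e T = c\<^sup>2 * ((1 + (tan \<phi>)\<^sup>2) / a ^ 4)"
        using a ab by (simp add: T_def e_def power_mult_distrib power_divide field_simps flip: power_mult)
      also have "1 + (tan \<phi>)\<^sup>2 = 1 / (cos \<phi>)\<^sup>2"
        using C tan_sec[of \<phi>] by (simp add: power_divide inverse_eq_divide)
      finally show ?thesis by (simp add: mult.commute)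
    qed
    have D: "D \<phi> > 0"
    proof -
      have "D \<phi> = q T * (a\<^sup>2 * (cos \<phi>)\<^sup>2)" using a C by (simp add: q_eq)
      then show ?thesis using q[of T] a C by simp
    qed
    have d_eq: "d T = D \<phi>"
      using a c C by (simp add: d_def q_eq e_eq power4_eq_xxxx power2_eq_square)
    have "e T / q T = (c / a)\<^sup>2 / D \<phi>"
      using a C D by (simp add: q_eq e_eq power4_eq_xxxx power2_eq_square)
    then have sqrt_eq: "sqrt (e T / q T) = c / a / sqrt (D \<phi>)"
      using a c by (simp add: real_sqrt_divide)
    have "D \<phi> powr (-3/2) = D \<phi> powr (-1) * D \<phi> powr (-1/2)"
      using powr_add[of "D \<phi>" "-1" "-1/2"] by simp
    also have "\<dots> = 1 / D \<phi> / sqrt (D \<phi>)"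
      using powr_neg_one[OF D] powr_minus_divide[of "D \<phi>" "1/2"] D by (simp add: powr_half_sqrt)
    finally have powr_eq: "D \<phi> powr (-3/2) = 1 / D \<phi> / sqrt (D \<phi>)" .
    have F_eq: "F T = 2 * (sqrt y / (D \<phi> / (a\<^sup>2 * (cos \<phi>)\<^sup>2)) * (c / a / sqrt (D \<phi>)) * J (D \<phi>))"
      by (simp only: F_def sqrt_eq d_eq q_eq[symmetric])
    show "2 * b\<^sup>2 * c * sqrt y / a * (D \<phi> powr (-3/2) * J (D \<phi>)) = b\<^sup>2 / a\<^sup>2 / (cos \<phi>)\<^sup>2 * F (b\<^sup>2 / a\<^sup>2 * tan \<phi>)"
      unfolding T_def[symmetric] F_eq powr_eq using a C D by (simp add: mult_ac)
  qed
  finally show ?thesis .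
qed

section \<open>The inner ellipse and the slopes of the surface\<close>

text \<open>The ellipse lies in the image of the unit circle under a diagonal linear map. On it the
  surface meets the plane z = 0 and the root is not differentiable, so the integrand may be changed
  there.\<close>

lemma negligible_ellipse:
  fixes a b :: real
  assumes "a > 0" "b > 0"
  shows "negligible {p :: real \<times> real. (fst p)\<^sup>2 / a\<^sup>2 + (snd p)\<^sup>2 / b\<^sup>2 = 1}"
proof -
  let ?T = "\<lambda>p :: real \<times> real. (a * fst p, b * snd p)"
  have "?T differentiable_on sphere 0 1"
    by (intro linear_imp_differentiable_on linearI) (auto simp: algebra_simps)
  then have "negligible (?T ` sphere 0 1)"
    by (intro negligible_differentiable_image_negligible negligible_sphere) simp
  moreover have "{p. (fst p)\<^sup>2 / a\<^sup>2 + (snd p)\<^sup>2 / b\<^sup>2 = 1} \<subseteq> ?T ` sphere 0 1"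
  proof
    fix p :: "real \<times> real"
    assume p: "p \<in> {p. (fst p)\<^sup>2 / a\<^sup>2 + (snd p)\<^sup>2 / b\<^sup>2 = 1}"
    have "p = ?T (fst p / a, snd p / b)" using assms by simp
    moreover have "(fst p / a, snd p / b) \<in> sphere 0 1"
      using p by (simp add: norm_prod_def power_divide)
    ultimately show "p \<in> ?T ` sphere 0 1" by blast
  qed
  ultimately show ?thesis by (rule negligible_subset)
qed

lemma deriv_hyperboloid:
  fixes c k l x :: real
  assumes "k \<noteq> 0" and pos: "0 < x\<^sup>2 / k + l"
  shows "deriv (\<lambda>t. c * sqrt (t\<^sup>2 / k + l)) x = c * (x / k) / sqrt (x\<^sup>2 / k + l)"
proof (rule DERIV_imp_deriv)
  have "((\<lambda>t. t\<^sup>2 / k + l) has_real_derivative 2 * x / k) (at x)"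
    using \<open>k \<noteq> 0\<close> by (auto intro!: derivative_eq_intros)
  from DERIV_cmult[OF DERIV_chain2[OF DERIV_real_sqrt[OF pos] this], of c]
  show "((\<lambda>t. c * sqrt (t\<^sup>2 / k + l)) has_real_derivative c * (x / k) / sqrt (x\<^sup>2 / k + l)) (at x)"
    by (rule DERIV_cong) (simp add: inverse_eq_divide)
qed

section \<open>Area of the hyperboloid and its triple series\<close>

text \<open>The triple series is read as an iterated sum with p outermost, following the order of
  the expansions. The three summability claims make each \<open>suminf\<close> a genuine sum, and
  \<open>has_integral\<close> includes existence of the area integral.\<close>

theorem theorem4:
  fixes a b c H lam :: real and z :: "real \<Rightarrow> real \<Rightarrow> real"
  assumes "a > b" "b > 0" "c > 0" "H > 0"
    and lam_def: "lam = sqrt (1 + H\<^sup>2 / c\<^sup>2)"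
    and hw: "\<bar>a\<^sup>2 * (1 - lam\<^sup>2) / (c\<^sup>2 * lam\<^sup>2)\<bar> < 1"
    and z_def: "z = (\<lambda>x y. c * sqrt (x\<^sup>2 / a\<^sup>2 + y\<^sup>2 / b\<^sup>2 - 1))"
  shows "(\<forall>n p. summable (\<lambda>m. sd_term (b\<^sup>2/a\<^sup>2 - 1) (1 - 1/lam\<^sup>2) (a\<^sup>2 * (1 - lam\<^sup>2) / (c\<^sup>2 * lam\<^sup>2)) m n p))
    \<and> (\<forall>p. summable (\<lambda>n. \<Sum>m. sd_term (b\<^sup>2/a\<^sup>2 - 1) (1 - 1/lam\<^sup>2) (a\<^sup>2 * (1 - lam\<^sup>2) / (c\<^sup>2 * lam\<^sup>2)) m n p))
    \<and> summable (\<lambda>p. \<Sum>n. \<Sum>m. sd_term (b\<^sup>2/a\<^sup>2 - 1) (1 - 1/lam\<^sup>2) (a\<^sup>2 * (1 - lam\<^sup>2) / (c\<^sup>2 * lam\<^sup>2)) m n p)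
    \<and> ((\<lambda>(x, y). sqrt (1 + (deriv (\<lambda>t. z t y) x)\<^sup>2 + (deriv (\<lambda>t. z x t) y)\<^sup>2))
        has_integral
        (2 * pi * b\<^sup>2 * c * sqrt (lam\<^sup>2 - 1) / (lam * a)
          * (\<Sum>p. \<Sum>n. \<Sum>m. sd_term (b\<^sup>2/a\<^sup>2 - 1) (1 - 1/lam\<^sup>2) (a\<^sup>2 * (1 - lam\<^sup>2) / (c\<^sup>2 * lam\<^sup>2)) m n p)))
       {(x, y). 1 \<le> x\<^sup>2 / a\<^sup>2 + y\<^sup>2 / b\<^sup>2 \<and> x\<^sup>2 / a\<^sup>2 + y\<^sup>2 / b\<^sup>2 \<le> lam\<^sup>2}"
proof -
  have a: "a > 0" using assms by simp
  have lam2: "lam\<^sup>2 = 1 + H\<^sup>2 / c\<^sup>2" by (simp add: lam_def add_nonneg_nonneg)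
  have lam2_gt: "lam\<^sup>2 > 1" using \<open>c > 0\<close> \<open>H > 0\<close> by (simp add: lam2)
  have lam_pos: "lam > 0" using lam2_gt by (simp add: lam_def add_pos_nonneg)
  define x where "x = b\<^sup>2 / a\<^sup>2 - 1"
  define y where "y = 1 - 1 / lam\<^sup>2"
  define w where "w = a\<^sup>2 * (1 - lam\<^sup>2) / (c\<^sup>2 * lam\<^sup>2)"
  have x: "-1 < x" "x \<le> 0" "\<bar>x\<bar> < 1"
  proof -
    have "b\<^sup>2 \<le> a\<^sup>2" using assms by (intro power_mono) auto
    then have "b\<^sup>2 / a\<^sup>2 \<le> 1" using a by simp
    moreover have "b\<^sup>2 / a\<^sup>2 > 0" using a \<open>b > 0\<close> by simp
    ultimately show "-1 < x" "x \<le> 0" "\<bar>x\<bar> < 1" by (auto simp: x_def)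
  qed
  have y: "0 < y" "y < 1" "0 \<le> y"
  proof -
    have "1 / lam\<^sup>2 < 1" "0 < 1 / lam\<^sup>2" using lam2_gt lam_pos by (simp_all add: divide_less_eq)
    then show "0 < y" "y < 1" "0 \<le> y" by (simp_all add: y_def)
  qed
  have w: "\<bar>w\<bar> < 1" using hw by (simp add: w_def)
  \<comment> \<open>Since w < 0, the quantity under the root, 1 - w d s^2, is at least 1 for d >=
    0.\<close>
  have w_eq: "w = - (a\<^sup>2 * y / c\<^sup>2)"
    using lam2_gt lam_pos \<open>c > 0\<close> by (simp add: w_def y_def field_simps)
  define C where "C = (\<lambda>p. pochhammer (-1/2) p / fact p * w ^ p)"
  define Kt where "Kt = (\<lambda>p n. pochhammer 2 n / fact n * y ^ n / (2 * real (n + p) + 1))"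
  define Ft where "Ft = (\<lambda>p m. pochhammer (3/2 - real p) m / fact m * (-x) ^ m * (pochhammer (1/2) m / fact m))"
  have term_eq: "sd_term x y w m n p = C p * (Kt p n * Ft p m)" for m n p
    unfolding C_def Kt_def Ft_def by (rule sd_term_factorization)
  define D where "D = (\<lambda>\<phi>. 1 + x * (sin \<phi>)\<^sup>2)"
  have Ft: "summable (Ft p)" and F: "((\<lambda>t. D t powr (-(3/2 - real p))) has_integral pi * suminf (Ft p)) {-pi/2..pi/2}" for p
    using has_integral_one_plus_sin_squared_powr[OF x(3), of "3/2 - real p"]
    by (simp_all only: Ft_def D_def)
  have Kt: "summable (Kt p)" and K: "((\<lambda>s. s ^ (2 * p) / (1 - y * s\<^sup>2)\<^sup>2) has_integral suminf (Kt p)) {0..1}" for p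
    using has_integral_power_over_square[OF y(3,2), of p] by (simp_all only: Kt_def)
  define J where "J = (\<lambda>d. \<Sum>p. pochhammer (-1/2) p / fact p * w ^ p * d ^ p * suminf (Kt p))"
  have J: "((\<lambda>s. sqrt (1 - w * d * s\<^sup>2) / (1 - y * s\<^sup>2)\<^sup>2) has_integral J d) {0..1}" if "0 \<le> d" "d \<le> 1" for d
    unfolding J_def by (rule has_integral_sqrt_over_square(2)[OF y(3,2) w that K])
  note angular = has_integral_angular_series[OF x(1,2) y(3,2) w K F[unfolded D_def] J]
  define A where "A = (\<Sum>p. C p * (suminf (Kt p) * suminf (Ft p)))"
  have CKF: "summable (\<lambda>p. C p * (suminf (Kt p) * suminf (Ft p)))"
    and int: "((\<lambda>t. D t powr (-3/2) * J (D t)) has_integral pi * A) {-pi/2..pi/2}"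
    using angular by (simp_all only: C_def A_def D_def)

  \<comment> \<open>For fixed p the sums over m and n are those of \<open>Ft p\<close> and
    \<open>Kt p\<close> with constant factors pulled out.\<close>
  have sum_m: "(\<lambda>m. sd_term x y w m n p) sums (C p * (Kt p n * suminf (Ft p)))" for n p
    unfolding term_eq by (intro sums_mult summable_sums Ft)
  then have suminf_m: "(\<Sum>m. sd_term x y w m n p) = C p * (Kt p n * suminf (Ft p))" for n p
    by (simp add: sums_iff)
  have sum_n: "(\<lambda>n. \<Sum>m. sd_term x y w m n p) sums (C p * (suminf (Kt p) * suminf (Ft p)))" for p
    unfolding suminf_m by (intro sums_mult sums_mult2 summable_sums Kt)
  then have suminf_n: "(\<Sum>n. \<Sum>m. sd_term x y w m n p) = C p * (suminf (Kt p) * suminf (Ft p))" for p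
    by (simp add: sums_iff)

  define f where "f = (\<lambda>p. sqrt (1 + c\<^sup>2 * ((fst p)\<^sup>2 / a ^ 4 + (snd p)\<^sup>2 / b ^ 4) /
        ((fst p)\<^sup>2 / a\<^sup>2 + (snd p)\<^sup>2 / b\<^sup>2 - 1)))"
  define S where "S = {p. 1 \<le> (fst p)\<^sup>2 / a\<^sup>2 + (snd p)\<^sup>2 / b\<^sup>2 \<and> (fst p)\<^sup>2 / a\<^sup>2 + (snd p)\<^sup>2 / b\<^sup>2 \<le> 1 / (1 - y)}"
  define area where "area = 2 * b\<^sup>2 * c * sqrt y / a * (pi * A)"
  have nn: "(\<integral>\<^sup>+p. ennreal (f p * indicator S p) \<partial>lborel) = ennreal area"
    unfolding f_def S_def area_def
    using assms y J[unfolded w_eq] int[unfolded D_def x_def]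
    by (intro nn_integral_hyperboloid_area[where J = J]) auto
  \<comment> \<open>\<open>ennreal\<close> truncates negative reals to 0, so the sign is needed to
    recover a real integral from \<open>nn\<close>.\<close>
  have area_nonneg: "0 \<le> area"
  proof -
    have "0 \<le> pi * A"
    proof (rule has_integral_nonneg[OF int])
      fix t
      have "x * (sin t)\<^sup>2 \<le> 0" using x by (simp add: mult_nonpos_nonneg)
      moreover have "- x * (sin t)\<^sup>2 \<le> - x * 1"
        using x by (intro mult_left_mono) (auto simp: abs_square_le_1)
      ultimately have "0 \<le> D t" "D t \<le> 1" using x by (simp_all add: D_def)
      from has_integral_nonneg[OF J[OF this]] have "0 \<le> J (D t)"
        using \<open>0 \<le> D t\<close> y by (simp add: w_eq)
      then show "0 \<le> D t powr (-3/2) * J (D t)" by simp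
    qed
    moreover have "0 \<le> 2 * b\<^sup>2 * c * sqrt y / a" using a \<open>c > 0\<close> y by simp
    ultimately show ?thesis unfolding area_def by (metis mult_nonneg_nonneg)
  qed
  have "((\<lambda>p. f p * indicator S p) has_integral area) UNIV"
  proof (rule nn_integral_has_integral[OF _ _ nn area_nonneg])
    have "(\<lambda>p. f p * indicator S p) \<in> borel_measurable (borel \<Otimes>\<^sub>M borel)"
      unfolding f_def S_def by measurable
    then show "(\<lambda>p. f p * indicator S p) \<in> borel_measurable borel" by (simp only: borel_prod)
    show "0 \<le> f p * indicator S p" for p
      using assms by (auto simp: f_def S_def indicator_def intro!: add_nonneg_nonneg divide_nonneg_nonneg mult_nonneg_nonneg)
  qed
  moreover have "(\<lambda>p. f p * indicator S p) = (\<lambda>p. if p \<in> S then f p else 0)"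
    by (auto simp: indicator_def)
  ultimately have "(f has_integral area) S"
    by (simp only: has_integral_restrict_UNIV)
  then have "((\<lambda>(x, y). sqrt (1 + (deriv (\<lambda>t. z t y) x)\<^sup>2 + (deriv (\<lambda>t. z x t) y)\<^sup>2)) has_integral area) S"
  \<comment> \<open>Off the inner ellipse R > 0 and the squared slopes add up to the fraction in
    \<open>f\<close>. On it \<open>f\<close> divides by zero and \<open>deriv\<close> has no
    meaning, but the set is null.\<close>
  proof (rule has_integral_spike[OF negligible_ellipse[OF a \<open>b > 0\<close>], rotated])
    fix p assume p: "p \<in> S - {p. (fst p)\<^sup>2 / a\<^sup>2 + (snd p)\<^sup>2 / b\<^sup>2 = 1}"
    obtain u v where uv: "p = (u, v)" by force
    define R where "R = u\<^sup>2 / a\<^sup>2 + v\<^sup>2 / b\<^sup>2 - 1"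
    have R: "R > 0" using p by (auto simp: S_def uv R_def)
    have "deriv (\<lambda>t. z t v) u = c * (u / a\<^sup>2) / sqrt R"
      using deriv_hyperboloid[of "a\<^sup>2" u "v\<^sup>2 / b\<^sup>2 - 1" c] R a by (simp add: z_def R_def add_diff_eq)
    moreover have "deriv (\<lambda>t. z u t) v = c * (v / b\<^sup>2) / sqrt R"
      using deriv_hyperboloid[of "b\<^sup>2" v "u\<^sup>2 / a\<^sup>2 - 1" c] R \<open>b > 0\<close> by (simp add: z_def R_def algebra_simps)
    moreover have "(c * (u / a\<^sup>2) / sqrt R)\<^sup>2 + (c * (v / b\<^sup>2) / sqrt R)\<^sup>2 = c\<^sup>2 * (u\<^sup>2 / a ^ 4 + v\<^sup>2 / b ^ 4) / R"
      using R by (simp add: power_divide power_mult_distrib add_divide_distrib distrib_left flip: power_mult)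
    ultimately show "(case p of (x, y) \<Rightarrow> sqrt (1 + (deriv (\<lambda>t. z t y) x)\<^sup>2 + (deriv (\<lambda>t. z x t) y)\<^sup>2)) = f p"
      by (simp add: uv f_def R_def add.assoc)
  qed
  moreover have "S = {(x, y). 1 \<le> x\<^sup>2 / a\<^sup>2 + y\<^sup>2 / b\<^sup>2 \<and> x\<^sup>2 / a\<^sup>2 + y\<^sup>2 / b\<^sup>2 \<le> lam\<^sup>2}"
    by (auto simp: S_def y_def)
  moreover have "area = 2 * pi * b\<^sup>2 * c * sqrt (lam\<^sup>2 - 1) / (lam * a) * (\<Sum>p. \<Sum>n. \<Sum>m. sd_term x y w m n p)"
  proof -
    have "y = (lam\<^sup>2 - 1) / lam\<^sup>2" using lam_pos by (simp add: y_def diff_divide_distrib)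
    then have "sqrt y = sqrt (lam\<^sup>2 - 1) / lam" using lam_pos by (simp add: real_sqrt_divide)
    then show ?thesis by (simp add: area_def suminf_n A_def)
  qed
  ultimately show ?thesis
    using sum_m sum_n CKF unfolding x_def[symmetric] y_def[symmetric] w_def[symmetric]
    by (simp add: suminf_n sums_iff)
qed

end
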